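(* Let $H$ and $K$ be complex inner product spaces such that $\dim(H)\ge 2$. Suppose that $A:H\to K$ is a non-zero additive mapping preserving Euclidean orthogonality, and let $T:H\to K$ be the real-linear isometry such that $A=\gamma T$ for some positive real number $\gamma$. If $A$ has norm-dense range, then every non-zero point in $H$ is of pure complex type for $T$, and $A$ is a positive scalar multiple of a complex-linear or a conjugate-linear isometry.
   Context: Inner product spaces are not assumed complete or finite dimensional. A mapping $A:H\to K$ is additive if $A(x+y)=A(x)+A(y)$ for all $x,y\in H$. It preserves (Euclidean) orthogonality if $\langle x|y\rangle=0$ in $H$ implies $\langle A(x)|A(y)\rangle=0$ in $K$. Under the hypotheses ($A$ non-zero, additive, orthogonality preserving, $\dim(H)\ge2$, where $\dim$ is the complex dimension) it is known that there exist a positive real $\gamma$ and a real-linear isometry $T:H\to K$ with $A=\gamma T$; this $T$ is the real-linear isometry associated with $A$, it preserves orthogonality, and isometries are not assumed surjective. For a real-linear isometry $T:H\to K$ preserving orthogonality and each non-zero $z\in H$, there exist a unique $s(z)\in[-1,1]$ and a unique $\eta(z)\in K$ such that $\eta(z)\perp T(z)$ (that is, $\langle \eta(z)|T(z)\rangle=0$) and $T(iz)=i\,s(z)T(z)+\eta(z)$. The point $z$ is said to be of pure complex type for $T$ if $\eta(z)=0$ (in which case $s(z)\in\{\pm1\}$), and of mixed complex type for $T$ otherwise. *)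

theory Defs
  imports "HOL-Analysis.Analysis"
begin

class complex_vector = real_vector +
  fixes scaleC :: "complex \<Rightarrow> 'a \<Rightarrow> 'a" (infixr "*\<^sub>C" 75)
  assumes scaleC_add_right: "c *\<^sub>C (x + y) = c *\<^sub>C x + c *\<^sub>C y"
    and scaleC_add_left: "(c + d) *\<^sub>C x = c *\<^sub>C x + d *\<^sub>C x"
    and scaleC_scaleC: "c *\<^sub>C (d *\<^sub>C x) = (c * d) *\<^sub>C x"
    and scaleC_one: "1 *\<^sub>C x = x"
    and scaleR_scaleC: "r *\<^sub>R x = complex_of_real r *\<^sub>C x"

global_interpretation complex_vector: vector_space
  "scaleC :: complex \<Rightarrow> 'a \<Rightarrow> 'a::complex_vector"
  defines cdependent = complex_vector.dependent
    and cspan = complex_vector.span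
  by unfold_locales (rule scaleC_add_right scaleC_add_left scaleC_scaleC scaleC_one)+

text \<open>
  The inner product is linear in its first argument. Neither completeness nor
  finite dimension is required; the topology is that of the norm, through
  \<^class>\<open>real_normed_vector\<close>.
\<close>

class complex_inner = complex_vector + real_normed_vector +
  fixes cinner :: "'a \<Rightarrow> 'a \<Rightarrow> complex"
  assumes cinner_commute: "cinner x y = cnj (cinner y x)"
    and cinner_add_left: "cinner (x + y) z = cinner x z + cinner y z"
    and cinner_scaleC_left: "cinner (c *\<^sub>C x) y = c * cinner x y"
    and cinner_self_nonneg: "0 \<le> Re (cinner x x)"
    and cinner_self_eq_zero_iff: "cinner x x = 0 \<longleftrightarrow> x = 0"
    and norm_eq_sqrt_cinner: "norm x = sqrt (Re (cinner x x))"

text \<open>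
  The library's \<open>dim\<close> is a cardinality in \<^typ>\<open>nat\<close>, hence \<open>0\<close> in infinite
  dimension; a lower bound on the dimension is therefore stated through a (Hamel) basis.
\<close>

definition cdim_at_least :: "nat \<Rightarrow> 'a::complex_vector itself \<Rightarrow> bool" where
  "cdim_at_least n _ \<longleftrightarrow>
     (\<exists>B :: 'a set. \<not> cdependent B \<and> cspan B = UNIV \<and> (infinite B \<or> n \<le> card B))"

definition preserves_orthogonality :: "('a::complex_inner \<Rightarrow> 'b::complex_inner) \<Rightarrow> bool" where
  "preserves_orthogonality A \<longleftrightarrow> (\<forall>x y. cinner x y = 0 \<longrightarrow> cinner (A x) (A y) = 0)"

definition isometric :: "('a::real_normed_vector \<Rightarrow> 'b::real_normed_vector) \<Rightarrow> bool" where
  "isometric T \<longleftrightarrow> (\<forall>x. norm (T x) = norm x)"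

definition real_linear_isometry :: "('a::complex_inner \<Rightarrow> 'b::complex_inner) \<Rightarrow> bool" where
  "real_linear_isometry T \<longleftrightarrow> linear T \<and> isometric T"

definition complex_linear_isometry :: "('a::complex_inner \<Rightarrow> 'b::complex_inner) \<Rightarrow> bool" where
  "complex_linear_isometry T \<longleftrightarrow> Vector_Spaces.linear scaleC scaleC T \<and> isometric T"

definition conjugate_linear_isometry :: "('a::complex_inner \<Rightarrow> 'b::complex_inner) \<Rightarrow> bool" where
  "conjugate_linear_isometry T \<longleftrightarrow>
     (\<forall>x y. T (x + y) = T x + T y) \<and> (\<forall>c x. T (c *\<^sub>C x) = cnj c *\<^sub>C T x) \<and> isometric T"

text \<open>
  For a real-linear isometry \<open>T\<close> preserving orthogonality and \<open>z \<noteq> 0\<close>, exactly one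
  pair \<open>(s, \<eta>)\<close> satisfies the following, so that \<open>eta_part T z\<close> is well defined.
\<close>

definition type_decomposition ::
  "('a::complex_inner \<Rightarrow> 'b::complex_inner) \<Rightarrow> 'a \<Rightarrow> real \<Rightarrow> 'b \<Rightarrow> bool" where
  "type_decomposition T z s \<eta> \<longleftrightarrow>
     s \<in> {-1..1} \<and> cinner \<eta> (T z) = 0 \<and>
     T (\<i> *\<^sub>C z) = (\<i> * complex_of_real s) *\<^sub>C T z + \<eta>"

definition eta_part :: "('a::complex_inner \<Rightarrow> 'b::complex_inner) \<Rightarrow> 'a \<Rightarrow> 'b" where
  "eta_part T z = (THE \<eta>. \<exists>s. type_decomposition T z s \<eta>)"

definition pure_complex_type :: "('a::complex_inner \<Rightarrow> 'b::complex_inner) \<Rightarrow> 'a \<Rightarrow> bool" where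
  "pure_complex_type T z \<longleftrightarrow> z \<noteq> 0 \<and> eta_part T z = 0"

end

theory Submission
  imports Defs
begin

text \<open>
  First, \<open>A\<close> is a multiple of a real-linear isometry. For orthonormal \<open>x\<close>, \<open>u\<close>, the vectors
  \<open>a x + b u\<close> and \<open>c x + d u\<close> are orthogonal exactly when \<open>a cnj c + b cnj d = 0\<close>; applying \<open>A\<close>
  shows that the form \<open>(a, c) \<mapsto> \<langle>A(a x)|A(c x)\<rangle>\<close> depends on the product \<open>a cnj c\<close> only, and
  that the form attached to \<open>u\<close> is the same. So \<open>\<parallel>A(a x)\<parallel>\<^sup>2\<close> is an additive function of
  \<open>\<bar>a\<bar>\<^sup>2\<close>, and an additive real function that is nonnegative on the nonnegative reals is linear.
  This gives \<open>\<parallel>A v\<parallel> = \<gamma> \<parallel>v\<parallel>\<close> for all \<open>v\<close>, and polarisation turns additivity into real linearity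
  (\<open>norm_square_on_orthonormal_pair\<close>, \<open>additive_similarity_imp_linear\<close>).

  Next, let \<open>A = \<gamma> T\<close> and \<open>T(i z) = c T z + \<eta>\<close> with \<open>\<eta> \<perp> T z\<close>. Every \<open>v\<close> is a real combination of
  \<open>z\<close> and \<open>i z\<close> plus a vector orthogonal to \<open>z\<close>, so \<open>\<langle>T v|\<eta>\<rangle>\<close> is a real multiple of
  \<open>\<parallel>\<eta>\<parallel>\<^sup>2\<close>. A vector whose inner products with a dense set are all real vanishes, since \<open>i \<eta>\<close>
  would be at distance at least \<open>\<parallel>\<eta>\<parallel>\<close> from that set. Hence \<open>\<eta> = 0\<close>, and as \<open>T\<close> is isometric
  \<open>T(i z) = \<plusminus> i T z\<close> (\<open>pointwise_complex_or_conjugate\<close>).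

  Finally, the vectors obeying a given sign form a subgroup of \<open>H\<close>, and a group is never the union of
  two proper subgroups; so a single sign serves for all \<open>z\<close>.
\<close>

section \<open>Complex inner product algebra\<close>

lemma cinner_add_right:
  fixes x y z :: "'a::complex_inner"
  shows "cinner x (y + z) = cinner x y + cinner x z"
  by (metis cinner_commute cinner_add_left complex_cnj_add)

lemma cinner_scaleC_right:
  fixes x y :: "'a::complex_inner"
  shows "cinner x (c *\<^sub>C y) = cnj c * cinner x y"
  by (metis cinner_commute cinner_scaleC_left complex_cnj_mult)

lemma cinner_zero_left [simp]: "cinner 0 (y::'a::complex_inner) = 0"
  using cinner_add_left[of 0 0 y] by simp

lemma cinner_zero_right [simp]: "cinner (y::'a::complex_inner) 0 = 0"
  using cinner_add_right[of y 0 0] by simp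

lemma cinner_minus_left: "cinner (- x) (y::'a::complex_inner) = - cinner x y"
  using cinner_add_left[of x "- x" y] by (simp add: eq_neg_iff_add_eq_0 add.commute)

lemma cinner_minus_right: "cinner (x::'a::complex_inner) (- y) = - cinner x y"
  using cinner_add_right[of x y "- y"] by (simp add: eq_neg_iff_add_eq_0 add.commute)

lemma cinner_diff_left: "cinner (x - y) (z::'a::complex_inner) = cinner x z - cinner y z"
  using cinner_add_left[of x "- y" z] by (simp add: cinner_minus_left)

lemma cinner_diff_right: "cinner (x::'a::complex_inner) (y - z) = cinner x y - cinner x z"
  using cinner_add_right[of x y "- z"] by (simp add: cinner_minus_right)

lemma cinner_scaleR_left: "cinner (r *\<^sub>R x) (y::'a::complex_inner) = of_real r * cinner x y"
  by (simp add: scaleR_scaleC cinner_scaleC_left)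

lemma cinner_scaleR_right: "cinner (x::'a::complex_inner) (r *\<^sub>R y) = of_real r * cinner x y"
  by (simp add: scaleR_scaleC cinner_scaleC_right)

lemmas cinner_simps =
  cinner_add_left cinner_add_right cinner_diff_left cinner_diff_right
  cinner_scaleC_left cinner_scaleC_right cinner_scaleR_left cinner_scaleR_right

lemma cinner_self: "cinner x (x::'a::complex_inner) = complex_of_real ((norm x)\<^sup>2)"
proof -
  have "Im (cinner x x) = 0"
    using arg_cong[OF cinner_commute[of x x], of Im] by simp
  then show ?thesis
    by (simp add: complex_eq_iff norm_eq_sqrt_cinner cinner_self_nonneg)
qed

lemma cinner_eq_zero_commute: "cinner x (y::'a::complex_inner) = 0 \<longleftrightarrow> cinner y x = 0"
  by (metis cinner_commute complex_cnj_zero)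

lemma norm_add_square:
  "(norm (x + y :: 'a::complex_inner))\<^sup>2 = (norm x)\<^sup>2 + (norm y)\<^sup>2 + 2 * Re (cinner x y)"
proof -
  have "Re (cinner y x) = Re (cinner x y)"
    using cinner_commute[of y x] by simp
  moreover have "Re (cinner (x + y) (x + y)) =
      Re (cinner x x) + Re (cinner y y) + Re (cinner x y) + Re (cinner y x)"
    by (simp add: cinner_simps)
  ultimately show ?thesis
    by (simp add: cinner_self)
qed

lemma norm_diff_square:
  "(norm (x - y :: 'a::complex_inner))\<^sup>2 = (norm x)\<^sup>2 + (norm y)\<^sup>2 - 2 * Re (cinner x y)"
  using norm_add_square[of x "- y"] by (simp add: cinner_minus_right)

lemma norm_scaleC: "norm (c *\<^sub>C (x::'a::complex_inner)) = cmod c * norm x"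
proof -
  have "complex_of_real ((norm (c *\<^sub>C x))\<^sup>2) = c * cnj c * complex_of_real ((norm x)\<^sup>2)"
    unfolding cinner_self[symmetric] by (simp add: cinner_simps)
  also have "\<dots> = complex_of_real ((cmod c * norm x)\<^sup>2)"
    by (simp only: complex_norm_square[symmetric] power_mult_distrib of_real_mult)
  finally have "(norm (c *\<^sub>C x))\<^sup>2 = (cmod c * norm x)\<^sup>2"
    by (simp only: of_real_eq_iff)
  then show ?thesis
    by (simp add: power2_eq_iff_nonneg)
qed

lemma orthogonal_decomposition:
  fixes x v :: "'a::complex_inner"
  assumes "x \<noteq> 0"
  obtains a w where "v = a *\<^sub>C x + w" "cinner x w = 0"
proof
  define a where "a = cinner v x / cinner x x"
  show "v = a *\<^sub>C x + (v - a *\<^sub>C x)"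
    by simp
  have "cinner (v - a *\<^sub>C x) x = 0"
    using assms by (simp add: cinner_simps a_def cinner_self_eq_zero_iff)
  then show "cinner x (v - a *\<^sub>C x) = 0"
    by (simp add: cinner_eq_zero_commute)
qed

text \<open>
  A vector outside the complex line through \<open>x\<close> has a nonzero component orthogonal to \<open>x\<close>; such a
  vector exists because an independent set contained in a line has at most one element.
\<close>

lemma exists_orthogonal_unit_vector:
  fixes x :: "'a::complex_inner"
  assumes dim: "cdim_at_least 2 TYPE('a)" and "x \<noteq> 0"
  obtains u where "norm u = 1" "cinner x u = 0"
proof -
  obtain B :: "'a set" where B: "\<not> cdependent B" "infinite B \<or> 2 \<le> card B"
    using dim unfolding cdim_at_least_def by blast
  have "\<not> B \<subseteq> cspan {x}"
  proof
    assume "B \<subseteq> cspan {x}"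
    then have "finite B \<and> card B \<le> card {x}"
      using complex_vector.independent_span_bound[of "{x}" B] B(1) by simp
    then show False
      using B(2) by auto
  qed
  then obtain y where y: "y \<notin> cspan {x}"
    by blast
  obtain a w where aw: "y = a *\<^sub>C x + w" "cinner x w = 0"
    using orthogonal_decomposition[OF \<open>x \<noteq> 0\<close>] by blast
  have "a *\<^sub>C x \<in> cspan {x}"
    by (simp add: complex_vector.span_base complex_vector.span_scale)
  then have "w \<noteq> 0"
    using y aw(1) by auto
  show ?thesis
  proof
    show "norm ((1 / norm w) *\<^sub>R w) = 1" "cinner x ((1 / norm w) *\<^sub>R w) = 0"
      using \<open>w \<noteq> 0\<close> aw(2) by (simp_all add: cinner_simps)
  qed
qed

section \<open>Additive orthogonality preservers are multiples of isometries\<close>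

text \<open>
  The deviation of \<open>f\<close> from \<open>\<lambda>x. x * f 1\<close> is additive and vanishes on the integers, hence has
  period \<open>1\<close>. On \<open>[0, 1)\<close> positivity of \<open>f\<close> bounds it, and a bounded additive function is zero.
\<close>

lemma additive_nonneg_imp_linear:
  fixes f :: "real \<Rightarrow> real"
  assumes add: "\<And>x y. f (x + y) = f x + f y" and nonneg: "\<And>x. 0 \<le> x \<Longrightarrow> 0 \<le> f x"
  shows "f x = x * f 1"
proof -
  define g where "g x = f x - x * f 1" for x
  interpret g: Modules.additive g
    by unfold_locales (simp add: g_def add algebra_simps)
  have g_nat: "g (real n * x) = real n * g x" for n x
    by (induction n) (simp_all add: g.zero g.add algebra_simps)
  have g1: "g 1 = 0"
    by (simp add: g_def)
  have g_int: "g (of_int k) = 0" for k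
    using g_nat[of _ 1] by (cases k rule: int_cases2) (simp_all add: g1 g.minus)
  have bound: "\<bar>g x\<bar> \<le> f 1" for x
  proof -
    have "g x = g (frac x)"
      using g.add[of "frac x" "of_int \<lfloor>x\<rfloor>"] by (simp add: g_int frac_def)
    moreover have "0 \<le> f (frac x)" "f (frac x) \<le> f 1"
      using nonneg[of "frac x"] nonneg[of "1 - frac x"] add[of "frac x" "1 - frac x"] frac_lt_1[of x]
      by auto
    moreover have "0 \<le> frac x * f 1" "frac x * f 1 \<le> f 1"
      using nonneg[of 1] frac_lt_1[of x] by (auto intro: mult_left_le_one_le)
    ultimately show ?thesis
      using g_def[of "frac x"] by linarith
  qed
  have "g x = 0"
  proof (rule ccontr)
    assume "g x \<noteq> 0"
    then obtain n where "f 1 < real n * \<bar>g x\<bar>"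
      using reals_Archimedean3[of "\<bar>g x\<bar>"] by auto
    then show False
      using bound[of "real n * x"] by (simp add: g_nat abs_mult)
  qed
  then show ?thesis
    by (simp add: g_def)
qed

text \<open>
  The factor is computed from \<open>x\<close> alone, so that it does not change when the second vector \<open>u\<close> is
  varied; this is what makes the factor the same on all of \<open>H\<close>.
\<close>

lemma norm_square_on_orthonormal_pair:
  fixes A :: "'h::complex_inner \<Rightarrow> 'k::complex_inner"
  assumes add: "\<And>x y. A (x + y) = A x + A y" and orth: "preserves_orthogonality A"
    and "norm x = 1" "norm u = 1" "cinner x u = 0"
  shows "(norm (A (a *\<^sub>C x + b *\<^sub>C u)))\<^sup>2 = (norm (A x))\<^sup>2 * (norm (a *\<^sub>C x + b *\<^sub>C u))\<^sup>2"
proof -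
  have orthD: "cinner (A v) (A w) = 0" if "cinner v w = 0" for v w
    using orth that by (simp add: preserves_orthogonality_def)
  have self: "cinner x x = 1" "cinner u u = 1"
    using assms(3,4) by (simp_all add: cinner_self)
  have "cinner u x = 0"
    using assms(5) by (simp add: cinner_eq_zero_commute)
  have swap: "cinner (A (a *\<^sub>C x)) (A (c *\<^sub>C x)) = - cinner (A (b *\<^sub>C u)) (A (d *\<^sub>C u))"
    if "a * cnj c + b * cnj d = 0" for a b c d
  proof -
    have "cinner (A (a *\<^sub>C x + b *\<^sub>C u)) (A (c *\<^sub>C x + d *\<^sub>C u)) = 0"
      using that by (intro orthD) (simp add: cinner_simps self assms(5) \<open>cinner u x = 0\<close> mult.commute)
    moreover have "cinner (A (a *\<^sub>C x)) (A (d *\<^sub>C u)) = 0" "cinner (A (b *\<^sub>C u)) (A (c *\<^sub>C x)) = 0"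
      by (intro orthD; simp add: cinner_simps assms(5) \<open>cinner u x = 0\<close>)+
    ultimately show ?thesis
      by (simp add: add cinner_simps eq_neg_iff_add_eq_0)
  qed
  \<comment> \<open>The restriction of the common form to real products; both complex lines will be measured by it.\<close>
  define f where "f r = Re (cinner (A (complex_of_real r *\<^sub>C x)) (A x))" for r
  have f_add: "f (r + s) = f r + f s" for r s
    by (simp add: f_def scaleC_add_left add cinner_simps)
  have f_u: "(norm (A (b *\<^sub>C u)))\<^sup>2 = f ((cmod b)\<^sup>2)" for b
  proof -
    have "cinner (A (complex_of_real (- (cmod b)\<^sup>2) *\<^sub>C x)) (A (1 *\<^sub>C x))
        = - cinner (A (b *\<^sub>C u)) (A (b *\<^sub>C u))"
      by (rule swap) (use complex_norm_square[of b] in simp)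
    then have "f (- (cmod b)\<^sup>2) = - (norm (A (b *\<^sub>C u)))\<^sup>2"
      by (simp add: f_def cinner_self scaleC_one)
    moreover have "f 0 = 0"
      using f_add[of 0 0] by simp
    ultimately show ?thesis
      using f_add[of "(cmod b)\<^sup>2" "- (cmod b)\<^sup>2"] by simp
  qed
  \<comment> \<open>The form on the line of \<open>x\<close> is carried to that of \<open>u\<close>, where \<open>f_u\<close> applies.\<close>
  have f_x: "(norm (A (a *\<^sub>C x)))\<^sup>2 = f ((cmod a)\<^sup>2)" for a
  proof -
    have "cinner (A (a *\<^sub>C x)) (A (a *\<^sub>C x)) = - cinner (A ((-a) *\<^sub>C u)) (A (a *\<^sub>C u))"
      by (rule swap) simp
    also have "\<dots> = cinner (A (a *\<^sub>C u)) (A (a *\<^sub>C u))"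
      using add[of "(-a) *\<^sub>C u" "a *\<^sub>C u"] add[of 0 0] by (simp add: cinner_minus_left eq_neg_iff_add_eq_0[symmetric])
    finally show ?thesis
      using f_u[of a] by (simp add: cinner_self flip: of_real_power)
  qed
  have "0 \<le> f r" if "0 \<le> r" for r
    using f_x[of "complex_of_real (sqrt r)"] that by (metis abs_of_nonneg norm_of_real real_sqrt_ge_zero real_sqrt_pow2 zero_le_power2)
  then have f_lin: "f r = r * f 1" for r
    using additive_nonneg_imp_linear[of f] f_add by blast
  have f1: "f 1 = (norm (A x))\<^sup>2"
    using f_x[of 1] by (simp add: scaleC_one)
  have "(norm (A (a *\<^sub>C x + b *\<^sub>C u)))\<^sup>2 = (norm (A (a *\<^sub>C x)))\<^sup>2 + (norm (A (b *\<^sub>C u)))\<^sup>2"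
    using orthD[of "a *\<^sub>C x" "b *\<^sub>C u"] by (simp add: add norm_add_square cinner_simps assms(5))
  also have "\<dots> = (norm (A x))\<^sup>2 * ((cmod a)\<^sup>2 + (cmod b)\<^sup>2)"
    using f_lin[of "(cmod a)\<^sup>2"] f_lin[of "(cmod b)\<^sup>2"] by (simp add: f_x f_u f1 algebra_simps)
  also have "(cmod a)\<^sup>2 + (cmod b)\<^sup>2 = (norm (a *\<^sub>C x + b *\<^sub>C u))\<^sup>2"
    by (simp add: norm_add_square cinner_simps assms(3-5) norm_scaleC)
  finally show ?thesis .
qed

lemma additive_orthogonality_preserver_norm:
  fixes A :: "'h::complex_inner \<Rightarrow> 'k::complex_inner"
  assumes "cdim_at_least 2 TYPE('h)"
    and add: "\<And>x y. A (x + y) = A x + A y" and orth: "preserves_orthogonality A"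
    and "norm x = 1"
  shows "norm (A v) = norm (A x) * norm v"
proof -
  have "x \<noteq> 0"
    using assms(4) by auto
  obtain a w where aw: "v = a *\<^sub>C x + w" "cinner x w = 0"
    using orthogonal_decomposition[OF \<open>x \<noteq> 0\<close>] by blast
  obtain b u where bu: "norm u = 1" "cinner x u = 0" "w = b *\<^sub>C u"
  proof (cases "w = 0")
    case True
    then show ?thesis
      using exists_orthogonal_unit_vector[OF assms(1) \<open>x \<noteq> 0\<close>] that[of _ 0] by auto
  next
    case False
    then have "w = complex_of_real (norm w) *\<^sub>C ((1 / norm w) *\<^sub>R w)"
      by (simp flip: scaleR_scaleC)
    moreover have "norm ((1 / norm w) *\<^sub>R w) = 1" "cinner x ((1 / norm w) *\<^sub>R w) = 0"
      using False aw(2) by (simp_all add: cinner_simps)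
    ultimately show ?thesis
      using that by blast
  qed
  have "(norm (A v))\<^sup>2 = (norm (A x) * norm v)\<^sup>2"
    unfolding aw(1) bu(3) power_mult_distrib
    by (rule norm_square_on_orthonormal_pair[OF add orth assms(4) bu(1,2)])
  then show ?thesis
    by (simp add: power2_eq_iff_nonneg)
qed

text \<open>
  Polarisation uses additivity only, so \<open>A\<close> scales the real inner product by \<open>\<gamma>\<^sup>2\<close>. Expanding the
  square of the norm of \<open>A (r *\<^sub>R x) - r *\<^sub>R A x\<close> with these inner products gives \<open>0\<close>, which
  replaces a continuity argument through the rationals.
\<close>

lemma additive_similarity_imp_linear:
  fixes A :: "'h::complex_inner \<Rightarrow> 'k::complex_inner"
  assumes add: "\<And>x y. A (x + y) = A x + A y" and norm_A: "\<And>x. norm (A x) = \<gamma> * norm x"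
  shows "linear A"
proof (rule linearI)
  fix r x
  have inner: "Re (cinner (A v) (A w)) = \<gamma>\<^sup>2 * Re (cinner v w)" for v w
    using norm_add_square[of "A v" "A w"] norm_add_square[of v w]
    by (simp add: norm_A power_mult_distrib algebra_simps flip: add)
  have "(norm (A (r *\<^sub>R x) - r *\<^sub>R A x))\<^sup>2 = 0"
    by (simp add: norm_diff_square norm_A cinner_scaleR_left cinner_scaleR_right inner cinner_self
        power_mult_distrib) (simp add: power2_eq_square algebra_simps)
  then show "A (r *\<^sub>R x) = r *\<^sub>R A x"
    by simp
qed (rule add)

lemma additive_orthogonality_preserver_multiple_of_isometry:
  fixes A :: "'h::complex_inner \<Rightarrow> 'k::complex_inner"
  assumes "cdim_at_least 2 TYPE('h)" and "\<exists>x. A x \<noteq> 0"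
    and add: "\<And>x y. A (x + y) = A x + A y" and orth: "preserves_orthogonality A"
  shows "\<exists>\<gamma> T. \<gamma> > 0 \<and> real_linear_isometry T \<and> (\<forall>x. A x = \<gamma> *\<^sub>R T x)"
proof -
  obtain y where "A y \<noteq> 0"
    using assms(2) by blast
  moreover have "A 0 = 0"
    using add[of 0 0] by simp
  ultimately have "y \<noteq> 0"
    by auto
  define x where "x = (1 / norm y) *\<^sub>R y"
  define \<gamma> where "\<gamma> = norm (A x)"
  have "norm x = 1"
    using \<open>y \<noteq> 0\<close> by (simp add: x_def)
  then have norm_A: "norm (A v) = \<gamma> * norm v" for v
    unfolding \<gamma>_def by (rule additive_orthogonality_preserver_norm[OF assms(1) add orth])
  have "\<gamma> > 0"
    using norm_A[of x] norm_A[of y] \<open>A y \<noteq> 0\<close> \<open>norm x = 1\<close>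
    by (metis mult_eq_0_iff norm_eq_zero norm_ge_zero \<gamma>_def less_le)
  show ?thesis
  proof (intro exI conjI allI)
    have "linear (\<lambda>x. (1 / \<gamma>) *\<^sub>R A x)"
      by (rule linear_compose_scale_right[OF additive_similarity_imp_linear[OF add norm_A]])
    then show "real_linear_isometry (\<lambda>x. (1 / \<gamma>) *\<^sub>R A x)"
      using \<open>\<gamma> > 0\<close> by (simp add: real_linear_isometry_def isometric_def norm_A)
  qed (use \<open>\<gamma> > 0\<close> in auto)
qed

section \<open>Dense range excludes mixed complex type\<close>

text \<open>
  If \<open>\<langle>y|\<eta>\<rangle>\<close> is real, then \<open>y\<close> is orthogonal to \<open>i \<eta>\<close> for the real inner product, and by Pythagoras
  \<open>y\<close> is no closer to \<open>i \<eta>\<close> than \<open>0\<close> is.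
\<close>

lemma dense_real_pairing_imp_zero:
  fixes \<eta> :: "'k::complex_inner"
  assumes dense: "closure S = UNIV" and real: "\<And>y. y \<in> S \<Longrightarrow> Im (cinner y \<eta>) = 0"
  shows "\<eta> = 0"
proof (rule ccontr)
  assume "\<eta> \<noteq> 0"
  have "\<i> *\<^sub>C \<eta> \<in> closure S"
    using dense by simp
  then obtain y where y: "y \<in> S" "dist y (\<i> *\<^sub>C \<eta>) < norm \<eta>"
    using \<open>\<eta> \<noteq> 0\<close> unfolding closure_approachable by (meson zero_less_norm_iff)
  have "(norm \<eta>)\<^sup>2 \<le> (norm (y - \<i> *\<^sub>C \<eta>))\<^sup>2"
    using real[OF y(1)] by (simp add: norm_diff_square cinner_simps norm_scaleC)
  then show False
    using y(2) by (simp add: dist_norm)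
qed

lemma pointwise_complex_or_conjugate:
  fixes T :: "'h::complex_inner \<Rightarrow> 'k::complex_inner"
  assumes iso: "real_linear_isometry T" and orth: "preserves_orthogonality T"
    and dense: "closure (range T) = UNIV"
  shows "T (\<i> *\<^sub>C z) = \<i> *\<^sub>C T z \<or> T (\<i> *\<^sub>C z) = - (\<i> *\<^sub>C T z)"
proof (cases "z = 0")
  case True
  then show ?thesis
    using iso by (simp add: real_linear_isometry_def linear_0)
next
  case False
  interpret T: linear T
    using iso by (simp add: real_linear_isometry_def)
  have norm_T: "norm (T x) = norm x" for x
    using iso by (simp add: real_linear_isometry_def isometric_def)
  have orthD: "cinner (T v) (T w) = 0" if "cinner v w = 0" for v w
    using orth that by (simp add: preserves_orthogonality_def)
  have "T z \<noteq> 0"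
    using norm_T[of z] False by auto
  then obtain c \<eta> where c: "T (\<i> *\<^sub>C z) = c *\<^sub>C T z + \<eta>" "cinner (T z) \<eta> = 0"
    using orthogonal_decomposition by blast
  \<comment> \<open>\<open>\<eta>\<close> is orthogonal to \<open>T z\<close> and to the image of every \<open>w \<perp> z\<close>; only the real coefficient of
    \<open>T (i z)\<close> is left.\<close>
  have "Im (cinner (T v) \<eta>) = 0" for v
  proof -
    obtain a w where aw: "v = a *\<^sub>C z + w" "cinner z w = 0"
      using orthogonal_decomposition[OF False] by blast
    have "a *\<^sub>C z = Re a *\<^sub>R z + Im a *\<^sub>R (\<i> *\<^sub>C z)"
      by (simp add: scaleR_scaleC scaleC_scaleC flip: scaleC_add_left)
        (simp add: complex_eq mult.commute)
    then have Tv: "T v = Re a *\<^sub>R T z + Im a *\<^sub>R T (\<i> *\<^sub>C z) + T w"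
      using aw(1) by (simp add: T.add T.scale)
    have "cinner w z = 0"
      using aw(2) by (simp add: cinner_eq_zero_commute)
    then have "cinner (T w) (T z) = 0" "cinner (T w) (T (\<i> *\<^sub>C z)) = 0"
      by (auto intro!: orthD simp: cinner_simps)
    then have "cinner (T w) \<eta> = 0"
      by (simp add: c(1) cinner_simps)
    then show ?thesis
      by (simp add: Tv cinner_simps c cinner_self)
  qed
  then have "\<eta> = 0"
    using dense_real_pairing_imp_zero[OF dense] by blast
  then have Tiz: "T (\<i> *\<^sub>C z) = c *\<^sub>C T z"
    using c(1) by simp
  have "cmod c = 1"
    using norm_T[of "\<i> *\<^sub>C z"] norm_T[of z] False by (simp add: Tiz norm_scaleC)
  \<comment> \<open>The vectors \<open>i z\<close> and \<open>z\<close> are orthogonal for the real inner product, so their images are too.\<close>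
  have "(norm (T (\<i> *\<^sub>C z + z)))\<^sup>2 = (norm (\<i> *\<^sub>C z + z))\<^sup>2"
    by (simp add: norm_T)
  then have "Re c = 0"
    using False by (simp add: norm_T T.add Tiz norm_add_square norm_scaleC cinner_simps cinner_self \<open>cmod c = 1\<close>)
  then have "c = \<i> \<or> c = - \<i>"
    using \<open>cmod c = 1\<close> by (auto simp: complex_eq_iff cmod_def abs_if split: if_splits)
  then show ?thesis
    using Tiz by auto
qed

text \<open>
  Since \<open>eta_part\<close> is a definite description, uniqueness must be shown: the second component of any
  decomposition is here both a multiple of \<open>T z\<close> and orthogonal to it.
\<close>

lemma pure_complex_type_if:
  fixes T :: "'h::complex_inner \<Rightarrow> 'k::complex_inner"
  assumes "T z \<noteq> 0" "z \<noteq> 0"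
    and "T (\<i> *\<^sub>C z) = \<i> *\<^sub>C T z \<or> T (\<i> *\<^sub>C z) = - (\<i> *\<^sub>C T z)"
  shows "pure_complex_type T z"
proof -
  obtain s :: real where s: "s \<in> {-1..1}" "T (\<i> *\<^sub>C z) = (\<i> * complex_of_real s) *\<^sub>C T z"
  proof -
    show ?thesis
      using assms(3) that[of 1] that[of "-1"] by auto
  qed
  have "\<eta> = 0" if "type_decomposition T z s' \<eta>" for s' \<eta>
  proof -
    have \<eta>: "\<eta> = (\<i> * complex_of_real (s - s')) *\<^sub>C T z" "cinner \<eta> (T z) = 0"
      using that s(2)
      by (simp_all add: type_decomposition_def algebra_simps complex_vector.scale_left_diff_distrib)
    then have "cinner \<eta> \<eta> = 0"
      by (metis cinner_scaleC_right mult_zero_right)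
    then show ?thesis
      by (simp add: cinner_self_eq_zero_iff)
  qed
  moreover have "type_decomposition T z s 0"
    using s by (simp add: type_decomposition_def)
  ultimately have "eta_part T z = 0"
    unfolding eta_part_def by (intro the_equality) blast+
  then show ?thesis
    using assms(2) by (simp add: pure_complex_type_def)
qed

section \<open>From pointwise to global complex linearity\<close>

text \<open>
  If \<open>x\<close> violates the first sign and \<open>y\<close> the second, then \<open>x\<close> obeys the second and \<open>y\<close> the first, and
  \<open>x + y\<close> can obey neither.
\<close>

lemma complex_or_conjugate_linear_isometry:
  fixes T :: "'h::complex_inner \<Rightarrow> 'k::complex_inner"
  assumes iso: "real_linear_isometry T"
    and pt: "\<And>z. T (\<i> *\<^sub>C z) = \<i> *\<^sub>C T z \<or> T (\<i> *\<^sub>C z) = - (\<i> *\<^sub>C T z)"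
  shows "complex_linear_isometry T \<or> conjugate_linear_isometry T"
proof -
  interpret T: linear T
    using iso by (simp add: real_linear_isometry_def)
  have iso': "isometric T"
    using iso by (simp add: real_linear_isometry_def)
  have split: "c *\<^sub>C x = Re c *\<^sub>R x + Im c *\<^sub>R (\<i> *\<^sub>C x)" for c and x :: "'b::complex_inner"
    by (simp add: scaleR_scaleC scaleC_scaleC flip: scaleC_add_left)
      (simp add: complex_eq mult.commute)
  have "(\<forall>z. T (\<i> *\<^sub>C z) = \<i> *\<^sub>C T z) \<or> (\<forall>z. T (\<i> *\<^sub>C z) = - (\<i> *\<^sub>C T z))"
  proof (rule ccontr)
    assume "\<not> ?thesis"
    then obtain x y where x: "T (\<i> *\<^sub>C x) \<noteq> \<i> *\<^sub>C T x" and y: "T (\<i> *\<^sub>C y) \<noteq> - (\<i> *\<^sub>C T y)"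
      by blast
    then have "T (\<i> *\<^sub>C x) = - (\<i> *\<^sub>C T x)" "T (\<i> *\<^sub>C y) = \<i> *\<^sub>C T y"
      using pt by blast+
    then show False
      using pt[of "x + y"] x y by (auto simp: scaleC_add_right T.add)
  qed
  then show ?thesis
  proof
    assume i: "\<forall>z. T (\<i> *\<^sub>C z) = \<i> *\<^sub>C T z"
    have "T (c *\<^sub>C x) = c *\<^sub>C T x" for c x
      unfolding split[of c] by (simp add: T.add T.scale i)
    then have "Vector_Spaces.linear scaleC scaleC T"
      by unfold_locales (auto simp: T.add)
    then show ?thesis
      using iso' by (simp add: complex_linear_isometry_def)
  next
    assume i: "\<forall>z. T (\<i> *\<^sub>C z) = - (\<i> *\<^sub>C T z)"
    have "T (c *\<^sub>C x) = cnj c *\<^sub>C T x" for c x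
      unfolding split[of c x] split[of "cnj c"] by (simp add: T.add T.scale i)
    then show ?thesis
      using iso' by (simp add: conjugate_linear_isometry_def T.add)
  qed
qed

theorem corollary2p9:
  fixes A :: "'h::complex_inner \<Rightarrow> 'k::complex_inner"
  assumes dim_H: "cdim_at_least 2 TYPE('h)"
    and nonzero: "\<exists>x. A x \<noteq> 0"
    and additive: "\<And>x y. A (x + y) = A x + A y"
    and orth: "preserves_orthogonality A"
    and dense_range: "closure (range A) = UNIV"
  shows "(\<forall>\<gamma> T. \<gamma> > 0 \<and> real_linear_isometry T \<and> (\<forall>x. A x = \<gamma> *\<^sub>R T x) \<longrightarrow>
            (\<forall>z. z \<noteq> 0 \<longrightarrow> pure_complex_type T z))
       \<and> (\<exists>\<gamma> S. \<gamma> > 0 \<and> (complex_linear_isometry S \<or> conjugate_linear_isometry S) \<and>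
            (\<forall>x. A x = \<gamma> *\<^sub>R S x))"
proof -
  have pointwise: "T (\<i> *\<^sub>C z) = \<i> *\<^sub>C T z \<or> T (\<i> *\<^sub>C z) = - (\<i> *\<^sub>C T z)"
    if "\<gamma> > 0" "real_linear_isometry T" and A: "\<And>x. A x = \<gamma> *\<^sub>R T x" for \<gamma> T z
  proof (rule pointwise_complex_or_conjugate[OF that(2)])
    show "preserves_orthogonality T"
      using orth \<open>\<gamma> > 0\<close> by (simp add: preserves_orthogonality_def A cinner_simps)
    have "range T = (*\<^sub>R) (1 / \<gamma>) ` range A"
      using \<open>\<gamma> > 0\<close> by (simp add: A image_image)
    then have "closure (range T) = (*\<^sub>R) (1 / \<gamma>) ` UNIV"
      by (metis closure_scaleR dense_range)
    also have "\<dots> = UNIV"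
      using \<open>\<gamma> > 0\<close> by (intro surjI[where f = "(*\<^sub>R) \<gamma>"]) simp
    finally show "closure (range T) = UNIV" .
  qed
  have "pure_complex_type T z"
    if "\<gamma> > 0" "real_linear_isometry T" "\<And>x. A x = \<gamma> *\<^sub>R T x" "z \<noteq> 0" for \<gamma> T z
  proof (rule pure_complex_type_if)
    have "norm (T z) = norm z"
      using that(2) by (simp add: real_linear_isometry_def isometric_def)
    then show "T z \<noteq> 0"
      using \<open>z \<noteq> 0\<close> by auto
  qed (use that pointwise in blast)+
  moreover have "\<exists>\<gamma> S. \<gamma> > 0 \<and> (complex_linear_isometry S \<or> conjugate_linear_isometry S) \<and>
      (\<forall>x. A x = \<gamma> *\<^sub>R S x)"
  proof -
    obtain \<gamma> T where T: "\<gamma> > 0" "real_linear_isometry T" "\<And>x. A x = \<gamma> *\<^sub>R T x"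
      using additive_orthogonality_preserver_multiple_of_isometry[OF dim_H nonzero additive orth]
      by blast
    then show ?thesis
      using complex_or_conjugate_linear_isometry[OF T(2) pointwise[OF T]] by blast
  qed
  ultimately show ?thesis
    by blast
qed

end
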